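(* Let $\mathcal{A}_1=(Q,R_1,V_1,V_1',f_1)$ and $\mathcal{A}_2=(Q,R_2,V_2,V_2',f_2)$ be two stochastic cellular automata with the same set of states $Q$, with explicit global functions $F_1$ and $F_2$. Then $\mathcal{S}_{F_1}=\mathcal{S}_{F_2}$ if and only if for every configuration $c\in Q^{\mathbb{Z}}$ there is a measure $\gamma_c$ on $R_1^{\mathbb{Z}}\times R_2^{\mathbb{Z}}$ (depending on $c$) such that $\mathcal{A}_1$ and $\mathcal{A}_2$ are coupled on $c$ by $\gamma_c$.
   Context: A (one-dimensional) stochastic cellular automaton is a tuple $\mathcal{A}=(Q,R,V,V',f)$ where $Q$ (states) and $R$ (random symbols) are finite sets, $V=\{v_1,\dots,v_\rho\}$ and $V'=\{v'_1,\dots,v'_{\rho'}\}$ are finite subsets of $\mathbb{Z}$, and $f:Q^\rho\times R^{\rho'}\to Q$. Its explicit global function $F:Q^{\mathbb{Z}}\times R^{\mathbb{Z}}\to Q^{\mathbb{Z}}$ is $F(c,s)_z=f\big((c_{z+v_1},\dots,c_{z+v_\rho}),(s_{z+v'_1},\dots,s_{z+v'_{\rho'}})\big)$. Its stochastic global function maps $c\in Q^{\mathbb{Z}}$ to the Borel probability measure $\mathcal{S}_F(c)$ on $Q^{\mathbb{Z}}$ that is the law of $F(c,s)$ when $s$ is drawn from the uniform (i.i.d. uniform product) measure $\nu_R$ on $R^{\mathbb{Z}}$. A coupling of Borel probability measures $\mu_1$ on $R_1^{\mathbb{Z}}$ and $\mu_2$ on $R_2^{\mathbb{Z}}$ is a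 Borel probability measure $\gamma$ on $R_1^{\mathbb{Z}}\times R_2^{\mathbb{Z}}$ such that $\gamma(E_1\times R_2^{\mathbb{Z}})=\mu_1(E_1)$ and $\gamma(R_1^{\mathbb{Z}}\times E_2)=\mu_2(E_2)$ for all measurable $E_1,E_2$. Two stochastic cellular automata $\mathcal{A}_1,\mathcal{A}_2$ with the same state set $Q$ are coupled on $c\in Q^{\mathbb{Z}}$ by $\gamma$ if (1) $\gamma$ is a coupling of the uniform measures on $R_1^{\mathbb{Z}}$ and $R_2^{\mathbb{Z}}$, and (2) $\gamma\big(\{(s_1,s_2)\in R_1^{\mathbb{Z}}\times R_2^{\mathbb{Z}}:F_1(c,s_1)=F_2(c,s_2)\}\big)=1$. *)

theory Defs
  imports "HOL-Probability.Probability"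
begin

section \<open>Stochastic cellular automata\<close>

text \<open>
  The alphabets \<open>Q\<close> and \<open>R\<close> are (arbitrary) types of class \<^class>\<open>finite\<close>. The neighbourhoods
  \<open>V = {v\<^sub>1, \<dots>, v\<^sub>\<rho>}\<close> and \<open>V' = {v'\<^sub>1, \<dots>, v'\<^sub>\<rho>\<^sub>'}\<close> are given with their enumerations, as lists
  without repetition. The local rule takes its tuples in \<open>Q\<^sup>\<rho>\<close> and \<open>R\<^sup>\<rho>\<^sup>'\<close> as lists; its
  values on lists of any other length are never used.
\<close>

record ('q, 'r) sca =
  state_nbhd :: "int list"
  random_nbhd :: "int list"
  local_rule :: "'q list \<Rightarrow> 'r list \<Rightarrow> 'q"

definition stochastic_ca :: "('q::finite, 'r::finite) sca \<Rightarrow> bool" where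
  "stochastic_ca A \<longleftrightarrow> distinct (state_nbhd A) \<and> distinct (random_nbhd A)"

definition explicit_global :: "('q, 'r) sca \<Rightarrow> (int \<Rightarrow> 'q) \<Rightarrow> (int \<Rightarrow> 'r) \<Rightarrow> (int \<Rightarrow> 'q)" where
  "explicit_global A c s =
     (\<lambda>z. local_rule A (map (\<lambda>v. c (z + v)) (state_nbhd A)) (map (\<lambda>v. s (z + v)) (random_nbhd A)))"


section \<open>Measures on configurations\<close>

text \<open>
  The product \<open>\<sigma>\<close>-algebra on \<open>Q\<^sup>\<int>\<close>, which is the Borel \<open>\<sigma>\<close>-algebra of the product of the
  discrete topologies, see \<open>sets_config_space_eq_borel\<close> below. This only serves as the carrier
  of a measurable space.
\<close>

definition config_space :: "(int \<Rightarrow> 'q) measure" where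
  "config_space = Pi\<^sub>M UNIV (\<lambda>_. count_space UNIV)"

definition uniform_config :: "(int \<Rightarrow> 'r::finite) measure" where
  "uniform_config = Pi\<^sub>M UNIV (\<lambda>_. measure_pmf (pmf_of_set UNIV))"

definition stochastic_global ::
    "('q::finite, 'r::finite) sca \<Rightarrow> (int \<Rightarrow> 'q) \<Rightarrow> (int \<Rightarrow> 'q) measure" where
  "stochastic_global A c = distr uniform_config config_space (explicit_global A c)"

definition coupling :: "'a measure \<Rightarrow> 'b measure \<Rightarrow> ('a \<times> 'b) measure \<Rightarrow> bool" where
  "coupling M1 M2 \<gamma> \<longleftrightarrow>
     prob_space \<gamma> \<and> sets \<gamma> = sets (M1 \<Otimes>\<^sub>M M2) \<and>
     (\<forall>E1\<in>sets M1. emeasure \<gamma> (E1 \<times> space M2) = emeasure M1 E1) \<and>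
     (\<forall>E2\<in>sets M2. emeasure \<gamma> (space M1 \<times> E2) = emeasure M2 E2)"

definition coupled_on ::
    "('q::finite, 'r1::finite) sca \<Rightarrow> ('q, 'r2::finite) sca \<Rightarrow> (int \<Rightarrow> 'q) \<Rightarrow>
     ((int \<Rightarrow> 'r1) \<times> (int \<Rightarrow> 'r2)) measure \<Rightarrow> bool" where
  "coupled_on A1 A2 c \<gamma> \<longleftrightarrow>
     coupling uniform_config uniform_config \<gamma> \<and>
     emeasure \<gamma> {(s1, s2). explicit_global A1 c s1 = explicit_global A2 c s2} = 1"


section \<open>Agreement with the Borel \<open>\<sigma>\<close>-algebras, and measurability\<close>

definition config_topology :: "(int \<Rightarrow> 'q) topology" where
  "config_topology = product_topology (\<lambda>_. discrete_topology UNIV) UNIV"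

definition cyl :: "(int \<times> 'q) list \<Rightarrow> (int \<Rightarrow> 'q) set" where
  "cyl l = {c. \<forall>(i, a)\<in>set l. c i = a}"

lemma space_config_space [simp]: "space config_space = UNIV"
  by (simp add: config_space_def space_PiM)

lemma space_uniform_config [simp]: "space uniform_config = UNIV"
  by (simp add: uniform_config_def space_PiM)

lemma sets_uniform_config [simp, measurable_cong]: "sets uniform_config = sets config_space"
  unfolding uniform_config_def config_space_def by (rule sets_PiM_cong) auto

lemma prob_space_uniform_config: "prob_space uniform_config"
  unfolding uniform_config_def by (intro prob_space_PiM measure_pmf.prob_space_axioms)

lemma measurable_config_component [measurable]:
  "(\<lambda>c. c i) \<in> measurable config_space (count_space UNIV)"
  unfolding config_space_def by simp

lemma topspace_config_topology [simp]: "topspace config_topology = UNIV"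
  by (simp add: config_topology_def)

lemma countable_cylinders: "countable (UNIV :: (int \<times> 'q::finite) list set)"
proof -
  have "countable (UNIV :: (int \<times> 'q) set)"
    by (simp add: UNIV_Times_UNIV[symmetric] countable_finite del: UNIV_Times_UNIV)
  then have "countable (lists (UNIV :: (int \<times> 'q) set))" by (rule countable_lists)
  then show ?thesis by simp
qed

lemma cyl_measurable: "cyl l \<in> sets (config_space :: (int \<Rightarrow> 'q) measure)"
proof -
  have "cyl l = {c \<in> space config_space. \<forall>p\<in>set l. c (fst p) = snd p}"
    by (auto simp: cyl_def)
  also have "\<dots> \<in> sets config_space" by measurable
  finally show ?thesis .
qed

lemma openin_config_component: "openin config_topology {c. c i \<in> A}"
proof -
  have "continuous_map config_topology (discrete_topology UNIV) (\<lambda>c. c i)"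
    unfolding config_topology_def by (rule continuous_map_product_coordinates) simp
  then have "openin config_topology {c \<in> topspace config_topology. c i \<in> A}"
    by (rule openin_continuous_map_preimage) simp
  then show ?thesis by simp
qed

lemma openin_config_cyl:
  assumes "openin config_topology W" "c \<in> W"
  obtains l where "c \<in> cyl l" "cyl l \<subseteq> W"
proof -
  obtain U where U: "finite {i. U i \<noteq> UNIV}" "c \<in> Pi\<^sub>E UNIV U" "Pi\<^sub>E UNIV U \<subseteq> W"
    using assms unfolding config_topology_def openin_product_topology_alt by auto
  obtain js where js: "set js = {i. U i \<noteq> UNIV}" using finite_list[OF U(1)] by blast
  let ?l = "map (\<lambda>i. (i, c i)) js"
  have "d \<in> W" if "d \<in> cyl ?l" for d
  proof -
    have "d i \<in> U i" for i
    proof (cases "i \<in> set js")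
      case True
      then have "d i = c i" using that by (auto simp: cyl_def)
      then show ?thesis using U(2) by (auto simp: PiE_iff)
    next
      case False
      then show ?thesis using js by auto
    qed
    then show ?thesis using U(3) by (auto simp: PiE_iff)
  qed
  then show ?thesis by (intro that[of ?l]) (auto simp: cyl_def)
qed

lemma sets_config_space_eq_borel:
  "sets (config_space :: (int \<Rightarrow> 'q::finite) measure) =
     sigma_sets UNIV {W. openin config_topology W}"
proof
  show "sets (config_space :: (int \<Rightarrow> 'q) measure) \<subseteq> sigma_sets UNIV {W. openin config_topology W}"
    unfolding config_space_def sets_PiM_single space_count_space PiE_UNIV_domain Pi_UNIV
    by (intro sigma_sets_mono) (auto simp: openin_config_component intro!: sigma_sets.Basic)
  have "W \<in> sets config_space" if W: "openin config_topology W" for W :: "(int \<Rightarrow> 'q) set"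
  proof -
    have "W = (\<Union>l\<in>{l. cyl l \<subseteq> W}. cyl l)" using openin_config_cyl[OF W] by blast
    also have "\<dots> \<in> sets config_space"
      by (rule sets.countable_UN'') (auto intro: cyl_measurable countable_subset[OF _ countable_cylinders])
    finally show ?thesis .
  qed
  then show "sigma_sets UNIV {W. openin config_topology W} \<subseteq> sets (config_space :: (int \<Rightarrow> 'q) measure)"
    using sets.sigma_sets_subset[of "{W. openin config_topology W}" config_space] by auto
qed

lemma sets_pair_config_space_eq_borel:
  "sets ((config_space :: (int \<Rightarrow> 'r1::finite) measure) \<Otimes>\<^sub>M (config_space :: (int \<Rightarrow> 'r2::finite) measure)) =
     sigma_sets UNIV {W. openin (prod_topology config_topology config_topology) W}"
    (is "sets ?M = sigma_sets UNIV ?O")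
proof
  have rect: "{c. c i \<in> A} \<times> {d. d j \<in> B} \<in> ?O" for i j and A :: "'r1 set" and B :: "'r2 set"
    by (simp add: openin_prod_Times_iff openin_config_component)
  let ?N = "sigma UNIV ?O"
  have sN: "sets ?N = sigma_sets UNIV ?O" and spN: "space ?N = UNIV" by auto
  have f: "fst \<in> measurable ?N (config_space :: (int \<Rightarrow> 'r1) measure)"
    unfolding config_space_def
  proof (rule measurable_PiM_single')
    fix i :: int
    show "(\<lambda>w. fst w i) \<in> measurable ?N (count_space (UNIV :: 'r1 set))"
    proof (rule measurableI)
      fix A :: "'r1 set"
      have "(\<lambda>w. fst w i) -` A \<inter> space ?N = {c. c i \<in> A} \<times> {d. d 0 \<in> UNIV}"
        using spN by auto
      then show "(\<lambda>w. fst w i) -` A \<inter> space ?N \<in> sets ?N"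
        unfolding sN using rect[of i A 0 UNIV] by auto
    qed simp
  qed simp
  have g: "snd \<in> measurable ?N (config_space :: (int \<Rightarrow> 'r2) measure)"
    unfolding config_space_def
  proof (rule measurable_PiM_single')
    fix i :: int
    show "(\<lambda>w. snd w i) \<in> measurable ?N (count_space (UNIV :: 'r2 set))"
    proof (rule measurableI)
      fix A :: "'r2 set"
      have "(\<lambda>w. snd w i) -` A \<inter> space ?N = {c. c 0 \<in> UNIV} \<times> {d. d i \<in> A}"
        using spN by auto
      then show "(\<lambda>w. snd w i) -` A \<inter> space ?N \<in> sets ?N"
        unfolding sN using rect[of 0 UNIV i A] by auto
    qed simp
  qed simp
  have "sets ?M \<subseteq> sets ?N"
  proof (rule sets_pair_in_sets)
    fix a :: "(int \<Rightarrow> 'r1) set" and b :: "(int \<Rightarrow> 'r2) set"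
    assume "a \<in> sets config_space" "b \<in> sets config_space"
    then have "(fst -` a \<inter> space ?N) \<inter> (snd -` b \<inter> space ?N) \<in> sets ?N"
      using f g by (intro sets.Int measurable_sets)
    moreover have "(fst -` a \<inter> space ?N) \<inter> (snd -` b \<inter> space ?N) = a \<times> b"
      using spN by auto
    ultimately show "a \<times> b \<in> sets ?N" by simp
  qed
  then show "sets ?M \<subseteq> sigma_sets UNIV ?O" using sN by simp
  have "W \<in> sets ?M" if W: "W \<in> ?O" for W
  proof -
    have "\<exists>l m. w \<in> cyl l \<times> cyl m \<and> cyl l \<times> cyl m \<subseteq> W" if wW: "w \<in> W" for w
    proof -
      obtain c d where w: "w = (c, d)" by (cases w)
      obtain U V where "openin config_topology U" "openin config_topology V" "c \<in> U" "d \<in> V"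
          "U \<times> V \<subseteq> W"
        using W wW unfolding mem_Collect_eq openin_prod_topology_alt w by meson
      moreover obtain l where "c \<in> cyl l" "cyl l \<subseteq> U"
        using openin_config_cyl[OF calculation(1,3)] by blast
      moreover obtain m where "d \<in> cyl m" "cyl m \<subseteq> V"
        using openin_config_cyl[OF calculation(2,4)] by blast
      ultimately have "w \<in> cyl l \<times> cyl m" "cyl l \<times> cyl m \<subseteq> W" unfolding w by blast+
      then show ?thesis by blast
    qed
    then have "W = (\<Union>p\<in>{p. cyl (fst p) \<times> cyl (snd p) \<subseteq> W}. cyl (fst p) \<times> cyl (snd p))"
      by fastforce
    also have "\<dots> \<in> sets ?M"
    proof (rule sets.countable_UN'')
      have "countable ((UNIV :: (int \<times> 'r1) list set) \<times> (UNIV :: (int \<times> 'r2) list set))"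
        by (intro countable_SIGMA countable_cylinders)
      then show "countable {p :: (int \<times> 'r1) list \<times> (int \<times> 'r2) list. cyl (fst p) \<times> cyl (snd p) \<subseteq> W}"
        by (rule countable_subset[rotated]) auto
    qed (auto intro: cyl_measurable)
    finally show ?thesis .
  qed
  then show "sigma_sets UNIV ?O \<subseteq> sets ?M"
    using sets.sigma_sets_subset[of ?O ?M] by (auto simp: space_pair_measure)
qed

lemma measurable_explicit_global [measurable]:
  fixes A :: "('q::finite, 'r::finite) sca"
  shows "explicit_global A c \<in> measurable config_space config_space"
proof -
  have lists: "(\<lambda>s :: int \<Rightarrow> 'r. map (\<lambda>v. s (z + v)) vs) \<in> measurable config_space (count_space UNIV)"
    for z :: int and vs
  proof (induction vs)
    case Nil
    then show ?case by simp
  next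
    case (Cons v vs)
    have "(\<lambda>s :: int \<Rightarrow> 'r. s (z + v) # map (\<lambda>v. s (z + v)) vs)
            \<in> measurable config_space (count_space UNIV)"
    proof (rule measurable_compose_countable'[where I = UNIV and g = "\<lambda>s. s (z + v)"
            and f = "\<lambda>a s. a # map (\<lambda>v. s (z + v)) vs"])
      show "(\<lambda>s. a # map (\<lambda>v. s (z + v)) vs) \<in> measurable config_space (count_space UNIV)" for a :: 'r
        by (rule measurable_compose[OF Cons.IH]) simp
    qed (auto intro: countable_finite)
    then show ?case by simp
  qed
  have "explicit_global A c \<in> measurable config_space (Pi\<^sub>M UNIV (\<lambda>_. count_space UNIV))"
    unfolding explicit_global_def
    by (rule measurable_PiM_single') (auto intro!: measurable_compose[OF lists])
  then show ?thesis by (simp only: config_space_def)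
qed

lemma coincidence_set_measurable:
  fixes A1 :: "('q::finite, 'r1::finite) sca" and A2 :: "('q, 'r2::finite) sca"
  shows "{(s1, s2). explicit_global A1 c s1 = explicit_global A2 c s2}
           \<in> sets (uniform_config \<Otimes>\<^sub>M uniform_config)"
proof -
  let ?M = "(config_space :: (int \<Rightarrow> 'r1) measure) \<Otimes>\<^sub>M (config_space :: (int \<Rightarrow> 'r2) measure)"
  have 1: "(\<lambda>w. explicit_global A1 c (fst w) z) \<in> measurable ?M (count_space UNIV)" for z
    by measurable
  have 2: "(\<lambda>w. explicit_global A2 c (snd w) z) \<in> measurable ?M (count_space UNIV)" for z
    by measurable
  have "{w \<in> space ?M. explicit_global A1 c (fst w) z = explicit_global A2 c (snd w) z} \<in> sets ?M" for z
  proof -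
    have "{w \<in> space ?M. explicit_global A1 c (fst w) z = explicit_global A2 c (snd w) z} =
        (\<Union>a\<in>UNIV. ((\<lambda>w. explicit_global A1 c (fst w) z) -` {a} \<inter> space ?M) \<inter>
                   ((\<lambda>w. explicit_global A2 c (snd w) z) -` {a} \<inter> space ?M))" by auto
    also have "\<dots> \<in> sets ?M"
      by (intro sets.finite_UN sets.Int measurable_sets[OF 1] measurable_sets[OF 2]) auto
    finally show ?thesis .
  qed
  then have "(\<Inter>z. {w \<in> space ?M. explicit_global A1 c (fst w) z = explicit_global A2 c (snd w) z})
      \<in> sets ?M"
    using sets.top[of ?M] by (intro sets.countable_INT'') (auto simp: space_pair_measure)
  moreover have "(\<Inter>z. {w \<in> space ?M. explicit_global A1 c (fst w) z = explicit_global A2 c (snd w) z})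
      = {(s1, s2). explicit_global A1 c s1 = explicit_global A2 c s2}"
    by (auto simp: space_pair_measure fun_eq_iff)
  moreover have "sets (uniform_config \<Otimes>\<^sub>M uniform_config) = sets ?M"
    by (rule sets_pair_measure_cong) simp_all
  ultimately show ?thesis by simp
qed

end

(*
  If F1(c,.) and F2(c,.) push the uniform measures to the same law L on configurations, let the
  two random configurations be conditionally independent given the common image: gamma(A x B) is
  the integral of P(A | F1 = q) P(B | F2 = q) over L(dq). Instead of regular conditional
  probabilities, only Radon-Nikodym densities are used: they make A, B |-> gamma(A x B) finitely
  additive in each argument, with no exceptional null sets, and Kolmogorov's extension theorem
  turns its values on cylinders into a measure. The rules are local, so
  {F1(c,.)_z = x} and {F2(c,.)_z = y} are finite unions of cylinders, and gamma of their product
  vanishes for x \<noteq> y.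
*)
theory Submission
  imports Defs
begin

section \<open>Kolmogorov extension over a finite alphabet\<close>

text \<open>\<open>m J f\<close> is meant as the mass of the cylinder that prescribes
  \<open>f\<close> on \<open>J\<close>. Consistency under removal of one coordinate,
  \<open>m_sum\<close>, yields projectivity of the finite-dimensional marginals by induction, and
  \<open>m_empty\<close> normalises the total mass; the projective limit is then the required
  measure.\<close>

lemma finite_alphabet_extension:
  fixes m :: "'i set \<Rightarrow> ('i \<Rightarrow> 'c::finite) \<Rightarrow> ennreal"
  assumes m_empty: "\<And>f. m {} f = 1"
    and m_local: "\<And>J f g. finite J \<Longrightarrow> (\<And>i. i \<in> J \<Longrightarrow> f i = g i) \<Longrightarrow> m J f = m J g"
    and m_sum: "\<And>J i f. finite J \<Longrightarrow> i \<notin> J \<Longrightarrow> (\<Sum>c\<in>UNIV. m (insert i J) (f(i := c))) = m J f"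
  obtains M where "prob_space M" "sets M = sets (Pi\<^sub>M UNIV (\<lambda>_. count_space UNIV))"
    "\<And>J f. finite J \<Longrightarrow> emeasure M {g. \<forall>i\<in>J. g i = f i} = m J f"
proof -
  \<comment> \<open>The library's extension theorem needs a Polish component type, hence the detour through the
    type of discrete copies.\<close>
  define m' where "m' J h = m J (\<lambda>i. of_discrete (h i))" for J and h :: "'i \<Rightarrow> 'c discrete"
  \<comment> \<open>For finite \<open>J\<close> this marginal is a sum of point masses;
    \<open>distr\<close> along the identity only replaces the power set by the product
    sigma-algebra.\<close>
  define P where "P J = distr (point_measure (Pi\<^sub>E J (\<lambda>_. UNIV)) (m' J)) (Pi\<^sub>M J (\<lambda>_. borel)) (\<lambda>x. x)" for J
  let ?B = "\<lambda>_::'i. borel :: 'c discrete measure"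
  have fin: "finite (UNIV :: 'c discrete set)"
    by (metis finite finite_imageI type_definition.Abs_image type_definition_discrete)
  have finPi: "finite (Pi\<^sub>E J (\<lambda>_. UNIV :: 'c discrete set))" if "finite J" for J :: "'i set"
    using that fin by (intro finite_PiE) auto
  have sets_P [simp]: "sets (P J) = sets (Pi\<^sub>M J ?B)" for J by (simp add: P_def)
  have space_P [simp]: "space (P J) = Pi\<^sub>E J (\<lambda>_. UNIV)" for J by (simp add: P_def space_PiM)
  have P_eq: "emeasure (P J) E = (\<Sum>h\<in>E. m' J h)" if J: "finite J" and E: "E \<in> sets (Pi\<^sub>M J ?B)" for J E
  proof -
    have sub: "E \<subseteq> Pi\<^sub>E J (\<lambda>_. UNIV)" using sets.sets_into_space[OF E] by (simp add: space_PiM)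
    have meas: "(\<lambda>x. x) \<in> measurable (point_measure (Pi\<^sub>E J (\<lambda>_. UNIV)) (m' J)) (Pi\<^sub>M J ?B)"
      by (simp add: space_PiM)
    have "emeasure (P J) E = emeasure (point_measure (Pi\<^sub>E J (\<lambda>_. UNIV)) (m' J)) E"
      unfolding P_def using sub
      by (subst emeasure_distr[OF meas E]) (simp add: space_point_measure Int_absorb2)
    also have "\<dots> = (\<Sum>h\<in>E. m' J h)"
      by (rule emeasure_point_measure_finite[OF finPi[OF J] sub])
    finally show ?thesis .
  qed
  have restr: "(\<lambda>f. restrict f J) \<in> measurable (Pi\<^sub>M H ?B) (Pi\<^sub>M J ?B)" if "J \<subseteq> H" for J H
    using that by (rule measurable_restrict_subset)
  \<comment> \<open>The fibre of the restriction over \<open>h\<close> consists of the points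
    \<open>h(i := discrete c)\<close>, so \<open>m_sum\<close> says exactly that the masses along
    each fibre add up.\<close>
  have step: "P J = distr (P (insert i J)) (Pi\<^sub>M J ?B) (\<lambda>f. restrict f J)"
    if J: "finite J" and i: "i \<notin> J" for i J
  proof (rule measure_eqI)
    fix E assume "E \<in> sets (P J)"
    then have E: "E \<in> sets (Pi\<^sub>M J ?B)" by simp
    have sub: "E \<subseteq> Pi\<^sub>E J (\<lambda>_. UNIV)" using sets.sets_into_space[OF E] by (simp add: space_PiM)
    let ?E' = "(\<lambda>f. restrict f J) -` E \<inter> Pi\<^sub>E (insert i J) (\<lambda>_. UNIV)"
    have r: "(\<lambda>f. restrict f J) \<in> measurable (P (insert i J)) (Pi\<^sub>M J ?B)"
      using restr[of J "insert i J"] by (simp add: measurable_cong_sets[OF sets_P refl] subset_insertI)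
    have E': "?E' \<in> sets (Pi\<^sub>M (insert i J) ?B)"
      using measurable_sets[OF r E] by simp
    have "emeasure (distr (P (insert i J)) (Pi\<^sub>M J ?B) (\<lambda>f. restrict f J)) E = (\<Sum>k\<in>?E'. m' (insert i J) k)"
      using J by (simp add: emeasure_distr[OF r E] P_eq[OF _ E'])
    also have "\<dots> = (\<Sum>(h, c)\<in>E \<times> UNIV. m' (insert i J) (h(i := discrete c)))"
    proof (rule sum.reindex_bij_witness[where j = "\<lambda>k. (restrict k J, of_discrete (k i))"
          and i = "\<lambda>(h, c). h(i := discrete c)"])
      fix k assume k: "k \<in> ?E'"
      show eq: "(case (restrict k J, of_discrete (k i)) of (h, c) \<Rightarrow> h(i := discrete c)) = k"
        using k by (auto simp: fun_eq_iff PiE_iff extensional_def restrict_def of_discrete_inverse)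
      then show "(case (restrict k J, of_discrete (k i)) of (h, c) \<Rightarrow> m' (insert i J) (h(i := discrete c)))
          = m' (insert i J) k" by simp
      show "(restrict k J, of_discrete (k i)) \<in> E \<times> UNIV" using k by simp
    next
      fix p :: "('i \<Rightarrow> 'c discrete) \<times> 'c" assume p: "p \<in> E \<times> UNIV"
      obtain h c where hc: "p = (h, c)" by (cases p)
      have h: "h \<in> E" "h \<in> Pi\<^sub>E J (\<lambda>_. UNIV)" using p sub hc by auto
      have rh: "restrict (h(i := discrete c)) J = h"
        using h(2) i by (auto simp: fun_eq_iff PiE_iff extensional_def restrict_def)
      show "(restrict (case p of (h, c) \<Rightarrow> h(i := discrete c)) J,
          of_discrete ((case p of (h, c) \<Rightarrow> h(i := discrete c)) i)) = p"
        using hc rh by (simp add: discrete_inverse)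
      show "(case p of (h, c) \<Rightarrow> h(i := discrete c)) \<in> ?E'"
        using hc rh h by (auto simp: PiE_iff extensional_def)
    qed
    also have "\<dots> = (\<Sum>h\<in>E. \<Sum>c\<in>UNIV. m' (insert i J) (h(i := discrete c)))"
      by (simp add: sum.cartesian_product)
    also have "\<dots> = (\<Sum>h\<in>E. m' J h)"
    proof (rule sum.cong[OF refl])
      fix h :: "'i \<Rightarrow> 'c discrete"
      have "(\<lambda>j. of_discrete ((h(i := discrete c)) j)) = (\<lambda>j. of_discrete (h j))(i := c)" for c
        by (auto simp: fun_eq_iff discrete_inverse)
      then show "(\<Sum>c\<in>UNIV. m' (insert i J) (h(i := discrete c))) = m' J h"
        unfolding m'_def using m_sum[OF J i, of "\<lambda>j. of_discrete (h j)"] by simp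
    qed
    finally show "emeasure (P J) E = emeasure (distr (P (insert i J)) (Pi\<^sub>M J ?B) (\<lambda>f. restrict f J)) E"
      by (simp add: P_eq[OF J E])
  qed simp
  \<comment> \<open>The coordinates of \<open>K\<close> are added one at a time, and the
    restrictions compose; a coordinate already in \<open>J\<close> changes nothing.\<close>
  have proj: "P J = distr (P (J \<union> K)) (Pi\<^sub>M J ?B) (\<lambda>f. restrict f J)"
    if "finite J" "finite K" for J K
    using that(2)
  proof induction
    case empty
    have "distr (P J) (Pi\<^sub>M J ?B) (\<lambda>f. restrict f J) = distr (P J) (P J) (\<lambda>x. x)"
      by (rule distr_cong) (auto simp: PiE_iff extensional_restrict)
    then show ?case by (simp only: Un_empty_right distr_id)
  next
    case (insert i K)
    show ?case
    proof (cases "i \<in> J")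
      case True
      then show ?thesis using insert by (simp add: insert_absorb)
    next
      case False
      have r: "(\<lambda>f. restrict f (J \<union> K)) \<in> measurable (P (insert i (J \<union> K))) (Pi\<^sub>M (J \<union> K) ?B)"
        using restr[of "J \<union> K" "insert i (J \<union> K)"]
        by (simp add: measurable_cong_sets[OF sets_P refl] subset_insertI)
      have PJK: "P (J \<union> K) = distr (P (insert i (J \<union> K))) (Pi\<^sub>M (J \<union> K) ?B) (\<lambda>f. restrict f (J \<union> K))"
        using insert.hyps False that(1) by (intro step) auto
      have "P J = distr (distr (P (insert i (J \<union> K))) (Pi\<^sub>M (J \<union> K) ?B) (\<lambda>f. restrict f (J \<union> K)))
          (Pi\<^sub>M J ?B) (\<lambda>f. restrict f J)"
        using insert.IH unfolding PJK .
      also have "\<dots> = distr (P (insert i (J \<union> K))) (Pi\<^sub>M J ?B) ((\<lambda>f. restrict f J) \<circ> (\<lambda>f. restrict f (J \<union> K)))"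
        by (rule distr_distr[OF restr r]) simp
      also have "(\<lambda>f. restrict f J) \<circ> (\<lambda>f. restrict f (J \<union> K)) = (\<lambda>f :: 'i \<Rightarrow> 'c discrete. restrict f J)"
        by (auto simp: fun_eq_iff restrict_def)
      finally show ?thesis by simp
    qed
  qed
  have proj': "P J = distr (P H) (Pi\<^sub>M J ?B) (\<lambda>f. restrict f J)" if "J \<subseteq> H" "finite H" for J H
    using proj[of J "H - J"] that finite_subset[OF that] by (simp add: Un_absorb1)
  have P_empty: "prob_space (P {})"
  proof
    have "emeasure (P {}) (Pi\<^sub>E {} (\<lambda>_. UNIV)) = 1"
      by (subst P_eq) (auto simp: m'_def m_empty PiM_empty)
    then show "emeasure (P {}) (space (P {})) = 1" by simp
  qed
  \<comment> \<open>The image on the one-point product over \<open>{}\<close> has mass 1, and an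
    image measure has the same total mass as its source.\<close>
  have prob_P: "prob_space (P J)" if "finite J" for J
  proof -
    have "(\<lambda>f. restrict f {}) \<in> measurable (P J) (Pi\<^sub>M {} ?B)"
      using restr[of "{}" J] by (simp add: measurable_cong_sets[OF sets_P refl])
    then show ?thesis
      using P_empty proj'[of "{}" J] that by (intro prob_space_distrD[of _ "P J"]) auto
  qed
  interpret polish_projective UNIV P
    by (rule polish_projective.intro, rule projective_family.intro) (erule (1) proj', erule prob_P)
  let ?C = "Pi\<^sub>M UNIV (\<lambda>_::'i. count_space (UNIV :: 'c set))"
  \<comment> \<open>Translates the limit measure back from discrete copies to the letters
    themselves.\<close>
  define D where "D = (\<lambda>(w :: 'i \<Rightarrow> 'c discrete) i. of_discrete (w i))"
  have "of_discrete \<in> measurable borel (count_space (UNIV :: 'c set))"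
    by (intro measurableI) (auto intro: borel_open open_discrete)
  then have D: "D \<in> measurable lim ?C"
    unfolding D_def measurable_cong_sets[OF sets_lim refl]
    by (intro measurable_PiM_single' measurable_compose[OF measurable_component_singleton]) auto
  show ?thesis
  proof (rule that[of "distr lim ?C D"])
    show "prob_space (distr lim ?C D)" using D by (rule P.prob_space_distr)
    fix J :: "'i set" and f :: "'i \<Rightarrow> 'c" assume J: "finite J"
    let ?S = "Pi\<^sub>E J (\<lambda>i. {discrete (f i)})"
    have S: "?S \<in> sets (Pi\<^sub>M J ?B)" using J by (intro sets_PiM_I_finite) auto
    have "{g. \<forall>i\<in>J. g i = f i} = prod_emb UNIV (\<lambda>_. count_space UNIV) J (Pi\<^sub>E J (\<lambda>i. {f i}))"
      by (auto simp: prod_emb_def PiE_iff)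
    also have "\<dots> \<in> sets ?C" using J by (intro sets_PiM_I) auto
    finally have "emeasure (distr lim ?C D) {g. \<forall>i\<in>J. g i = f i} = emeasure lim (D -` {g. \<forall>i\<in>J. g i = f i} \<inter> space lim)"
      by (rule emeasure_distr[OF D])
    also have "D -` {g. \<forall>i\<in>J. g i = f i} \<inter> space lim = prod_emb UNIV ?B J ?S"
    proof -
      have "of_discrete x = c \<longleftrightarrow> x = discrete c" for x and c :: 'c
        by (metis discrete_inverse of_discrete_inverse UNIV_I)
      then show ?thesis by (auto simp: prod_emb_def PiE_iff D_def space_PiM)
    qed
    also have "emeasure lim \<dots> = emeasure (P J) ?S"
      using J S by (intro emeasure_lim_emb) auto
    also have "\<dots> = (\<Sum>h\<in>{\<lambda>i\<in>J. discrete (f i)}. m' J h)"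
    proof -
      have "?S = {\<lambda>i\<in>J. discrete (f i)}"
        by (auto simp: PiE_iff extensional_def restrict_def fun_eq_iff)
      then show ?thesis using P_eq[OF J S] by simp
    qed
    \<comment> \<open>The single point in the sum is \<open>undefined\<close> off \<open>J\<close>,
      unlike \<open>f\<close>; \<open>m_local\<close> bridges the difference.\<close>
    also have "\<dots> = m J f"
      unfolding m'_def using J by (auto intro!: m_local simp: discrete_inverse)
    finally show "emeasure (distr lim ?C D) {g. \<forall>i\<in>J. g i = f i} = m J f" .
  qed simp
qed

section \<open>Conditional independence given the common image\<close>

text \<open>A version of P(B | X2 = x) is evaluated at x = X1(a) and integrated over a in A. Since
  X1 and X2 have the same law, relations between such versions that hold almost everywhere for that
  law survive the substitution, and integration erases the exceptional sets. The index types
  \<open>'c\<close> and \<open>'d\<close> are parameters, later set to the two random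
  alphabets.\<close>

lemma conditional_independence_content:
  fixes X1 :: "'a \<Rightarrow> 'q" and X2 :: "'b \<Rightarrow> 'q"
  assumes M1: "prob_space M1" and M2: "prob_space M2"
    and X1 [measurable]: "X1 \<in> measurable M1 N" and X2 [measurable]: "X2 \<in> measurable M2 N"
    and same: "distr M1 N X1 = distr M2 N X2"
  obtains \<beta> :: "'a set \<Rightarrow> 'b set \<Rightarrow> ennreal" where
    "\<And>A. A \<in> sets M1 \<Longrightarrow> \<beta> A (space M2) = emeasure M1 A"
    "\<And>B. B \<in> sets M2 \<Longrightarrow> \<beta> (space M1) B = emeasure M2 B"
    "\<And>A B (I :: 'c set). finite I \<Longrightarrow> disjoint_family_on A I \<Longrightarrow> (\<And>i. i \<in> I \<Longrightarrow> A i \<in> sets M1) \<Longrightarrow> B \<in> sets M2 \<Longrightarrow>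
      \<beta> (\<Union>i\<in>I. A i) B = (\<Sum>i\<in>I. \<beta> (A i) B)"
    "\<And>A B (I :: 'd set). finite I \<Longrightarrow> disjoint_family_on B I \<Longrightarrow> (\<And>i. i \<in> I \<Longrightarrow> B i \<in> sets M2) \<Longrightarrow> A \<in> sets M1 \<Longrightarrow>
      \<beta> A (\<Union>i\<in>I. B i) = (\<Sum>i\<in>I. \<beta> A (B i))"
    "\<And>A B D. A \<in> sets M1 \<Longrightarrow> B \<in> sets M2 \<Longrightarrow> D \<in> sets N \<Longrightarrow> (\<And>a. a \<in> A \<Longrightarrow> X1 a \<in> D) \<Longrightarrow>
      (\<And>b. b \<in> B \<Longrightarrow> X2 b \<notin> D) \<Longrightarrow> \<beta> A B = 0"
proof -
  interpret M1: prob_space M1 by fact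
  interpret M2: prob_space M2 by fact
  define L where "L = distr M2 N X2"
  interpret L: prob_space L unfolding L_def using X2 by (rule M2.prob_space_distr)
  have sets_L [simp, measurable_cong]: "sets L = sets N" and space_L [simp]: "space L = space N"
    by (simp_all add: L_def)
  \<comment> \<open>The law of X2 restricted to the event \<open>B\<close>, of total mass
    P(B).\<close>
  define \<nu> where "\<nu> B = distr (density M2 (indicator B)) N X2" for B
  \<comment> \<open>\<open>\<kappa> B x\<close> is a version of the conditional probability of \<open>B\<close> given \<open>X2 = x\<close>.\<close>
  define \<kappa> where "\<kappa> B = RN_deriv L (\<nu> B)" for B
  have [measurable]: "\<kappa> B \<in> borel_measurable N" for B
    unfolding \<kappa>_def using borel_measurable_RN_deriv[of L] by (simp add: measurable_cong_sets[OF sets_L refl])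
  have \<nu>: "emeasure (\<nu> B) D = emeasure M2 (B \<inter> (X2 -` D \<inter> space M2))"
    if [measurable]: "B \<in> sets M2" "D \<in> sets N" for B D
  proof -
    have "emeasure (\<nu> B) D = emeasure (density M2 (indicator B)) (X2 -` D \<inter> space M2)"
      unfolding \<nu>_def by (subst emeasure_distr) auto
    also have "\<dots> = (\<integral>\<^sup>+x. indicator (B \<inter> (X2 -` D \<inter> space M2)) x \<partial>M2)"
      by (subst emeasure_density) (auto intro!: nn_integral_cong split: split_indicator simp del: nn_integral_indicator)
    also have "\<dots> = emeasure M2 (B \<inter> (X2 -` D \<inter> space M2))"
      by (rule nn_integral_indicator) measurable
    finally show ?thesis .
  qed
  have dens: "density L (\<kappa> B) = \<nu> B" if B [measurable]: "B \<in> sets M2" for B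
    unfolding \<kappa>_def
  proof (rule L.density_RN_deriv)
    \<comment> \<open>The mass that \<open>\<nu> B\<close> gives to \<open>D\<close> is at most P(X2
      in D), which is the mass under \<open>L\<close>.\<close>
    show "absolutely_continuous L (\<nu> B)"
      unfolding absolutely_continuous_def
    proof
      fix D assume "D \<in> null_sets L"
      then have D: "D \<in> sets N" "emeasure M2 (X2 -` D \<inter> space M2) = 0"
        by (auto simp: null_sets_def L_def emeasure_distr)
      then have "emeasure M2 (B \<inter> (X2 -` D \<inter> space M2)) = 0"
        using emeasure_mono[of "B \<inter> (X2 -` D \<inter> space M2)" "X2 -` D \<inter> space M2" M2] by auto
      then show "D \<in> null_sets (\<nu> B)" using D by (auto simp: null_sets_def \<nu>) (simp add: \<nu>_def)
    qed
  qed (simp add: \<nu>_def)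
  have int_\<kappa>: "(\<integral>\<^sup>+x\<in>D. \<kappa> B x \<partial>L) = emeasure M2 (B \<inter> (X2 -` D \<inter> space M2))"
    if "B \<in> sets M2" "D \<in> sets N" for B D
    using that \<nu>[OF that] dens[OF that(1), symmetric] by (simp add: emeasure_density)
  \<comment> \<open>Only \<open>B\<close> is conditioned; integrating over \<open>A\<close> itself
    replaces the factor P(A | X1 = x) and makes additivity in \<open>A\<close> immediate.\<close>
  define \<beta> where "\<beta> A B = (\<integral>\<^sup>+a\<in>A. \<kappa> B (X1 a) \<partial>M1)" for A B
  \<comment> \<open>For events determined by X1 the integral moves to the common law
    \<open>L\<close>, where \<open>int_\<kappa>\<close> evaluates it through X2. The second marginal
    and the vanishing property both come from this.\<close>
  have \<beta>_L: "\<beta> (X1 -` D \<inter> space M1) B = (\<integral>\<^sup>+x\<in>D. \<kappa> B x \<partial>L)" if [measurable]: "D \<in> sets N" for B D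
    unfolding L_def same[symmetric] \<beta>_def
    by (subst nn_integral_distr) (auto intro!: nn_integral_cong split: split_indicator)
  have AE1: "AE a in M1. Q (X1 a)" if "AE x in L. Q x" for Q
    using that unfolding L_def same[symmetric] by (rule AE_distrD[OF X1])
  show ?thesis
  proof (rule that[of \<beta>])
    fix A assume [measurable]: "A \<in> sets M1"
    \<comment> \<open>The measure \<open>\<nu> (space M2)\<close> is \<open>L\<close> itself, so its
      density is 1 almost everywhere.\<close>
    have "AE x in L. 1 = \<kappa> (space M2) x"
      unfolding \<kappa>_def
    proof (rule L.RN_deriv_unique)
      show "density L (\<lambda>_. 1) = \<nu> (space M2)"
        unfolding density_1
      proof (rule measure_eqI)
        fix D assume "D \<in> sets L"
        then show "emeasure L D = emeasure (\<nu> (space M2)) D"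
          by (subst \<nu>) (auto simp: L_def emeasure_distr Int_absorb1)
      qed (simp add: \<nu>_def)
    qed simp
    from AE1[OF this] have "\<beta> A (space M2) = (\<integral>\<^sup>+a\<in>A. 1 \<partial>M1)"
      unfolding \<beta>_def by (intro nn_integral_cong_AE) auto
    then show "\<beta> A (space M2) = emeasure M1 A" by simp
  next
    fix B assume B: "B \<in> sets M2"
    have "X1 -` space N \<inter> space M1 = space M1" "X2 -` space N \<inter> space M2 = space M2"
      using measurable_space[OF X1] measurable_space[OF X2] by auto
    then show "\<beta> (space M1) B = emeasure M2 B"
      using \<beta>_L[of "space N" B] int_\<kappa>[OF B, of "space N"] sets.sets_into_space[OF B]
      by (simp add: Int_absorb2)
  next
    fix A B and I :: "'c set"
    assume I: "finite I" "disjoint_family_on A I" and A [measurable]: "\<And>i. i \<in> I \<Longrightarrow> A i \<in> sets M1"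
    have "\<beta> (\<Union>i\<in>I. A i) B = (\<integral>\<^sup>+a. (\<Sum>i\<in>I. \<kappa> B (X1 a) * indicator (A i) a) \<partial>M1)"
      unfolding \<beta>_def
      by (intro nn_integral_cong)
        (simp add: indicator_UN_disjoint[OF I] sum_distrib_left)
    also have "\<dots> = (\<Sum>i\<in>I. \<beta> (A i) B)"
      unfolding \<beta>_def by (rule nn_integral_sum) measurable
    finally show "\<beta> (\<Union>i\<in>I. A i) B = (\<Sum>i\<in>I. \<beta> (A i) B)" .
  next
    fix A B and I :: "'d set"
    assume I: "finite I" "disjoint_family_on B I" and B [measurable]: "\<And>i. i \<in> I \<Longrightarrow> B i \<in> sets M2"
      and A [measurable]: "A \<in> sets M1"
    \<comment> \<open>Both sides are densities of the same measure \<open>\<nu>\<close> of the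
      union. The exceptional null set may vary with the family \<open>B\<close>, but the integral
      defining \<open>\<beta>\<close> does not see it.\<close>
    have "AE x in L. (\<Sum>i\<in>I. \<kappa> (B i) x) = \<kappa> (\<Union>i\<in>I. B i) x"
      unfolding \<kappa>_def[of "\<Union>i\<in>I. B i"]
    proof (rule L.RN_deriv_unique)
      show "density L (\<lambda>x. \<Sum>i\<in>I. \<kappa> (B i) x) = \<nu> (\<Union>i\<in>I. B i)"
      proof (rule measure_eqI)
        fix D assume "D \<in> sets (density L (\<lambda>x. \<Sum>i\<in>I. \<kappa> (B i) x))"
        then have D [measurable]: "D \<in> sets N" by simp
        have "emeasure (density L (\<lambda>x. \<Sum>i\<in>I. \<kappa> (B i) x)) D = (\<integral>\<^sup>+x. (\<Sum>i\<in>I. \<kappa> (B i) x * indicator D x) \<partial>L)"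
          by (subst emeasure_density) (auto simp: sum_distrib_right)
        also have "\<dots> = (\<Sum>i\<in>I. \<integral>\<^sup>+x\<in>D. \<kappa> (B i) x \<partial>L)"
          by (rule nn_integral_sum) measurable
        also have "\<dots> = (\<Sum>i\<in>I. emeasure M2 (B i \<inter> (X2 -` D \<inter> space M2)))"
          by (intro sum.cong refl int_\<kappa>) auto
        also have "\<dots> = emeasure M2 (\<Union>i\<in>I. B i \<inter> (X2 -` D \<inter> space M2))"
          using I by (intro sum_emeasure) (auto simp: disjoint_family_on_def)
        also have "\<dots> = emeasure (\<nu> (\<Union>i\<in>I. B i)) D"
          using I(1) by (subst \<nu>) auto
        finally show "emeasure (density L (\<lambda>x. \<Sum>i\<in>I. \<kappa> (B i) x)) D = emeasure (\<nu> (\<Union>i\<in>I. B i)) D" .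
      qed (simp add: \<nu>_def)
    qed measurable
    from AE1[OF this] have "\<beta> A (\<Union>i\<in>I. B i) = (\<integral>\<^sup>+a. (\<Sum>i\<in>I. \<kappa> (B i) (X1 a) * indicator A a) \<partial>M1)"
      unfolding \<beta>_def by (intro nn_integral_cong_AE) (auto simp: sum_distrib_right[symmetric])
    also have "\<dots> = (\<Sum>i\<in>I. \<beta> A (B i))"
      unfolding \<beta>_def by (rule nn_integral_sum) measurable
    finally show "\<beta> A (\<Union>i\<in>I. B i) = (\<Sum>i\<in>I. \<beta> A (B i))" .
  next
    fix A B D assume A: "A \<in> sets M1" and B: "B \<in> sets M2" and D: "D \<in> sets N"
      and AD: "\<And>a. a \<in> A \<Longrightarrow> X1 a \<in> D" and BD: "\<And>b. b \<in> B \<Longrightarrow> X2 b \<notin> D"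
    \<comment> \<open>Enlarging \<open>A\<close> to the full preimage of \<open>D\<close> under X1
      reduces the claim to P(B and X2 in D), an impossible event.\<close>
    have "\<beta> A B \<le> \<beta> (X1 -` D \<inter> space M1) B"
      unfolding \<beta>_def using AD sets.sets_into_space[OF A]
      by (intro nn_integral_mono) (auto split: split_indicator)
    also have "\<dots> = emeasure M2 (B \<inter> (X2 -` D \<inter> space M2))"
      using \<beta>_L[OF D] int_\<kappa>[OF B D] by simp
    also have "B \<inter> (X2 -` D \<inter> space M2) = {}" using BD by auto
    finally show "\<beta> A B = 0" by simp
  qed
qed

section \<open>Cylinders and the measures they determine\<close>

text \<open>Unlike \<open>cyl\<close>, whose list may prescribe two letters at one position, such a
  set always contains \<open>s\<close> and is never empty. The index set and the pattern are
  separate, which suits splitting along one more coordinate.\<close>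

definition cylinder_at :: "'i set \<Rightarrow> ('i \<Rightarrow> 'a) \<Rightarrow> ('i \<Rightarrow> 'a) set" where
  "cylinder_at J s = {t. \<forall>i\<in>J. t i = s i}"

lemma cylinder_at_empty [simp]: "cylinder_at {} s = UNIV"
  by (simp add: cylinder_at_def)

lemma cylinder_at_cong: "(\<And>i. i \<in> J \<Longrightarrow> s i = t i) \<Longrightarrow> cylinder_at J s = cylinder_at J t"
  by (auto simp: cylinder_at_def)

lemma cylinder_at_Int: "t \<in> cylinder_at J s \<inter> cylinder_at K s' \<Longrightarrow>
    cylinder_at J s \<inter> cylinder_at K s' = cylinder_at (J \<union> K) t"
  by (auto simp: cylinder_at_def)

lemma cylinder_at_split:
  "i \<notin> J \<Longrightarrow> cylinder_at J s = (\<Union>c. cylinder_at (insert i J) (s(i := c)))"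
  by (auto simp: cylinder_at_def)

lemma disjoint_cylinder_at: "disjoint_family (\<lambda>c. cylinder_at (insert i J) (s(i := c)))"
  by (auto simp: cylinder_at_def disjoint_family_on_def)

lemma cylinder_at_measurable:
  assumes "finite J"
  shows "cylinder_at J s \<in> sets (config_space :: (int \<Rightarrow> 'a::finite) measure)"
proof -
  obtain js where "set js = J" using finite_list[OF assms] by blast
  then have "cylinder_at J s = cyl (map (\<lambda>i. (i, s i)) js)"
    by (auto simp: cylinder_at_def cyl_def)
  then show ?thesis using cyl_measurable by simp
qed

text \<open>Uniqueness on an intersection-stable generator. Finitely many letters make every
  one-site event a finite union of cylinders, and the cylinder over \<open>{}\<close> is the whole
  space, so finiteness of \<open>M\<close> supplies the exhaustion.\<close>

lemma config_measure_eqI: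
  fixes M N :: "(int \<Rightarrow> 'a::finite) measure"
  assumes "finite_measure M" and M: "sets M = sets config_space" and N: "sets N = sets config_space"
    and eq: "\<And>J s. finite J \<Longrightarrow> emeasure M (cylinder_at J s) = emeasure N (cylinder_at J s)"
  shows "M = N"
proof -
  \<comment> \<open>The empty set is adjoined because two cylinders that disagree at a common
    position do not meet.\<close>
  define G :: "(int \<Rightarrow> 'a) set set" where "G = insert {} {cylinder_at J s |J s. finite J}"
  have G_cyl: "cylinder_at J s \<in> G" if "finite J" for J s using that by (auto simp: G_def)
  have "sigma_sets UNIV G = sets config_space"
  proof
    have "G \<subseteq> sets config_space" by (auto simp: G_def cylinder_at_measurable)
    then show "sigma_sets UNIV G \<subseteq> sets config_space"
      using sets.sigma_sets_subset[of G config_space] by simp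
    have "{f. f i \<in> A} \<in> sigma_sets UNIV G" for i :: int and A :: "'a set"
    proof -
      have "{f. f i \<in> A} = (\<Union>a\<in>A. cylinder_at {i} (\<lambda>_. a))" by (auto simp: cylinder_at_def)
      also have "\<dots> \<in> sigma_sets UNIV G"
        by (rule sigma_sets_UNION) (auto intro!: sigma_sets.Basic G_cyl countable_finite)
      finally show ?thesis .
    qed
    then show "sets config_space \<subseteq> sigma_sets UNIV G"
      unfolding config_space_def sets_PiM_single space_count_space PiE_UNIV_domain Pi_UNIV
      by (intro sigma_sets_mono) auto
  qed
  moreover have "Int_stable G"
  proof (rule Int_stableI)
    fix A B assume "A \<in> G" "B \<in> G"
    then consider "A \<inter> B = {}"
      | J s K s' t where "finite J" "finite K" "A = cylinder_at J s" "B = cylinder_at K s'" "t \<in> A \<inter> B"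
      unfolding G_def by blast
    then show "A \<inter> B \<in> G"
    proof cases
      case 1
      then show ?thesis by (simp add: G_def)
    next
      case 2
      then show ?thesis using cylinder_at_Int[of t J s K s'] by (auto intro: G_cyl)
    qed
  qed
  ultimately show ?thesis
    using assms(1)
    by (intro measure_eqI_generator_eq[where E = G and \<Omega> = UNIV and A = "\<lambda>_. UNIV"])
      (auto simp: M N G_def eq finite_measure.emeasure_finite
        intro: exI[of _ "{}"])
qed

text \<open>Used to identify marginals: the extension gives agreement with the content only on pairs
  of cylinders over one common index set, whereas a marginal has the whole space as one
  factor.\<close>

lemma cylinder_pair_refine:
  fixes \<mu> \<nu> :: "('i \<Rightarrow> 'a) set \<Rightarrow> ('i \<Rightarrow> 'b::finite) set \<Rightarrow> ennreal"
  assumes \<mu>: "\<And>J L i b. finite L \<Longrightarrow> finite J \<Longrightarrow> i \<notin> J \<Longrightarrow> \<mu> (cylinder_at L a) (cylinder_at J b)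
        = (\<Sum>c\<in>UNIV. \<mu> (cylinder_at L a) (cylinder_at (insert i J) (b(i := c))))"
    and \<nu>: "\<And>J L i b. finite L \<Longrightarrow> finite J \<Longrightarrow> i \<notin> J \<Longrightarrow> \<nu> (cylinder_at L a) (cylinder_at J b)
        = (\<Sum>c\<in>UNIV. \<nu> (cylinder_at L a) (cylinder_at (insert i J) (b(i := c))))"
    and eq: "\<And>J b. finite J \<Longrightarrow> \<mu> (cylinder_at J a) (cylinder_at J b) = \<nu> (cylinder_at J a) (cylinder_at J b)"
    and "finite J"
  shows "\<mu> (cylinder_at J a) UNIV = \<nu> (cylinder_at J a) UNIV"
proof -
  \<comment> \<open>Splitting the second cylinder along the coordinates of \<open>J\<close>, one at a time, leads to the
    case of equal index sets.\<close>
  have "\<mu> (cylinder_at (K \<union> J) a) (cylinder_at K b) = \<nu> (cylinder_at (K \<union> J) a) (cylinder_at K b)"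
    if "finite K" for K b
    using \<open>finite J\<close> that
  proof (induction J arbitrary: K b)
    case empty
    then show ?case by (simp add: eq)
  next
    case (insert i J)
    show ?case
    proof (cases "i \<in> K")
      case True
      then show ?thesis using insert.IH[OF insert.prems] by (simp add: insert_absorb)
    next
      case False
      have "\<mu> (cylinder_at (K \<union> insert i J) a) (cylinder_at (insert i K) (b(i := c))) =
          \<nu> (cylinder_at (K \<union> insert i J) a) (cylinder_at (insert i K) (b(i := c)))" for c
        using insert.IH[of "insert i K"] insert.prems by simp
      then show ?thesis using False insert.hyps insert.prems by (simp add: \<mu> \<nu>)
    qed
  qed
  from this[of "{}"] show ?thesis by simp
qed

lemma explicit_global_local:
  assumes "t \<in> cylinder_at ((\<lambda>v. z + v) ` set (random_nbhd A)) s"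
  shows "explicit_global A c t z = explicit_global A c s z"
  using assms by (auto simp: explicit_global_def cylinder_at_def intro!: arg_cong[where f = "local_rule A _"])

section \<open>From equal laws to a coupling\<close>

lemma coupled_on_if_same_law:
  fixes A1 :: "('q::finite, 'r1::finite) sca" and A2 :: "('q, 'r2::finite) sca"
  assumes same: "stochastic_global A1 c = stochastic_global A2 c"
  shows "\<exists>\<gamma>. coupled_on A1 A2 c \<gamma>"
proof -
  define F1 where "F1 = explicit_global A1 c"
  define F2 where "F2 = explicit_global A2 c"
  let ?U1 = "uniform_config :: (int \<Rightarrow> 'r1) measure"
  let ?U2 = "uniform_config :: (int \<Rightarrow> 'r2) measure"
  let ?C1 = "config_space :: (int \<Rightarrow> 'r1) measure"
  let ?C2 = "config_space :: (int \<Rightarrow> 'r2) measure"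
  have F: "F1 \<in> measurable ?U1 config_space" "F2 \<in> measurable ?U2 config_space"
    unfolding F1_def F2_def by measurable
  obtain \<beta> :: "(int \<Rightarrow> 'r1) set \<Rightarrow> (int \<Rightarrow> 'r2) set \<Rightarrow> ennreal" where
    \<beta>1: "\<And>A. A \<in> sets ?C1 \<Longrightarrow> \<beta> A UNIV = emeasure ?U1 A" and
    \<beta>2: "\<And>B. B \<in> sets ?C2 \<Longrightarrow> \<beta> UNIV B = emeasure ?U2 B" and
    \<beta>_add1: "\<And>A B (I :: 'r1 set). finite I \<Longrightarrow> disjoint_family_on A I \<Longrightarrow>
      (\<And>i. i \<in> I \<Longrightarrow> A i \<in> sets ?C1) \<Longrightarrow> B \<in> sets ?C2 \<Longrightarrow> \<beta> (\<Union>i\<in>I. A i) B = (\<Sum>i\<in>I. \<beta> (A i) B)" and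
    \<beta>_add2: "\<And>A B (I :: 'r2 set). finite I \<Longrightarrow> disjoint_family_on B I \<Longrightarrow>
      (\<And>i. i \<in> I \<Longrightarrow> B i \<in> sets ?C2) \<Longrightarrow> A \<in> sets ?C1 \<Longrightarrow> \<beta> A (\<Union>i\<in>I. B i) = (\<Sum>i\<in>I. \<beta> A (B i))" and
    \<beta>_null: "\<And>A B D. A \<in> sets ?C1 \<Longrightarrow> B \<in> sets ?C2 \<Longrightarrow> D \<in> sets config_space \<Longrightarrow>
      (\<And>a. a \<in> A \<Longrightarrow> F1 a \<in> D) \<Longrightarrow> (\<And>b. b \<in> B \<Longrightarrow> F2 b \<notin> D) \<Longrightarrow> \<beta> A B = 0"
    using conditional_independence_content[OF prob_space_uniform_config prob_space_uniform_config F
        same[unfolded stochastic_global_def, folded F1_def F2_def]]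
    by (simp only: sets_uniform_config space_uniform_config) blast
  have \<beta>_split1: "(\<Sum>c\<in>UNIV. \<beta> (cylinder_at (insert i J) (a(i := c))) B) = \<beta> (cylinder_at J a) B"
    if "finite J" "i \<notin> J" "B \<in> sets ?C2" for J i a B
    unfolding cylinder_at_split[OF that(2), of a]
    by (subst \<beta>_add1) (use that in \<open>auto simp: disjoint_cylinder_at cylinder_at_measurable\<close>)
  have \<beta>_split2: "(\<Sum>c\<in>UNIV. \<beta> A (cylinder_at (insert i J) (b(i := c)))) = \<beta> A (cylinder_at J b)"
    if "finite J" "i \<notin> J" "A \<in> sets ?C1" for J i b A
    unfolding cylinder_at_split[OF that(2), of b]
    by (subst \<beta>_add2) (use that in \<open>auto simp: disjoint_cylinder_at cylinder_at_measurable\<close>)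
  \<comment> \<open>A pair of configurations is read as one configuration over the product alphabet,
    so that the extension lemma applies; a cylinder there is a product of two cylinders over the
    same positions.\<close>
  define m where "m J w = \<beta> (cylinder_at J (fst \<circ> w)) (cylinder_at J (snd \<circ> w))"
    for J and w :: "int \<Rightarrow> 'r1 \<times> 'r2"
  have upd: "fst \<circ> w(i := p) = (fst \<circ> w)(i := fst p)" "snd \<circ> w(i := p) = (snd \<circ> w)(i := snd p)"
    for w :: "int \<Rightarrow> 'r1 \<times> 'r2" and i p
    by (auto simp: fun_eq_iff)
  obtain W where W: "prob_space W" "sets W = sets (Pi\<^sub>M UNIV (\<lambda>_. count_space UNIV))"
    and W_eq: "\<And>J f. finite J \<Longrightarrow> emeasure W {g. \<forall>i\<in>J. g i = f i} = m J f"
  proof (rule finite_alphabet_extension[of m])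
    interpret prob_space ?U1 by (rule prob_space_uniform_config)
    show "m {} f = 1" for f
      using \<beta>1[of UNIV] sets.top[of ?C1] emeasure_space_1 by (simp add: m_def)
    show "m J f = m J g" if "finite J" "\<And>i. i \<in> J \<Longrightarrow> f i = g i" for J f g
      unfolding m_def using that(2)
      by (intro arg_cong2[where f = \<beta>] cylinder_at_cong) auto
    fix J :: "int set" and i f assume J: "finite J" "i \<notin> J"
    \<comment> \<open>Summing over a pair of letters is summing over each component in turn, so
      additivity in each argument of \<open>\<beta>\<close> suffices.\<close>
    have "(\<Sum>p\<in>UNIV. m (insert i J) (f(i := p))) =
        (\<Sum>a\<in>UNIV. \<Sum>b\<in>UNIV. m (insert i J) (f(i := (a, b))))"
      by (simp add: sum.cartesian_product UNIV_Times_UNIV)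
    also have "\<dots> = m J f"
      using J by (simp add: m_def upd \<beta>_split1 \<beta>_split2 cylinder_at_measurable)
    finally show "(\<Sum>p\<in>UNIV. m (insert i J) (f(i := p))) = m J f" .
  qed (use that in blast)
  interpret W: prob_space W by fact
  have sW: "sets W = sets config_space" unfolding W(2) config_space_def ..
  have comp: "(\<lambda>w. h \<circ> w) \<in> measurable W config_space" for h :: "'r1 \<times> 'r2 \<Rightarrow> 'd"
    unfolding measurable_cong_sets[OF W(2) refl] unfolding config_space_def comp_def
    by (intro measurable_PiM_single' measurable_compose[OF measurable_component_singleton]) auto
  \<comment> \<open>Unzipping the configuration of pairs carries the measure to the product
    space.\<close>
  define \<gamma> where "\<gamma> = distr W (?C1 \<Otimes>\<^sub>M ?C2) (\<lambda>w. (fst \<circ> w, snd \<circ> w))"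
  have pair: "(\<lambda>w. (fst \<circ> w, snd \<circ> w)) \<in> measurable W (?C1 \<Otimes>\<^sub>M ?C2)"
    by (intro measurable_Pair comp)
  interpret \<gamma>: prob_space \<gamma> unfolding \<gamma>_def using pair by (rule W.prob_space_distr)
  have sets_\<gamma>: "sets \<gamma> = sets (?C1 \<Otimes>\<^sub>M ?C2)" by (simp add: \<gamma>_def)
  have rect: "A \<times> B \<in> sets \<gamma>" if "A \<in> sets ?C1" "B \<in> sets ?C2" for A B
    using that by (simp add: sets_\<gamma>)
  have \<gamma>_eq: "emeasure \<gamma> (cylinder_at J a \<times> cylinder_at J b) = \<beta> (cylinder_at J a) (cylinder_at J b)"
    if J: "finite J" for J a b
  proof -
    have "space W = UNIV" using sets_eq_imp_space_eq[OF sW] by simp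
    then have "(\<lambda>w. (fst \<circ> w, snd \<circ> w)) -` (cylinder_at J a \<times> cylinder_at J b) \<inter> space W
        = {w. \<forall>i\<in>J. w i = (a i, b i)}"
      by (auto simp: cylinder_at_def prod_eq_iff)
    then have "emeasure \<gamma> (cylinder_at J a \<times> cylinder_at J b) = emeasure W {w. \<forall>i\<in>J. w i = (a i, b i)}"
      unfolding \<gamma>_def using J by (subst emeasure_distr[OF pair]) (auto intro: cylinder_at_measurable)
    also have "\<dots> = \<beta> (cylinder_at J a) (cylinder_at J b)"
      unfolding W_eq[OF J] m_def by (simp add: comp_def)
    finally show ?thesis .
  qed
  have \<gamma>_split1: "(\<Sum>c\<in>UNIV. emeasure \<gamma> (cylinder_at (insert i J) (a(i := c)) \<times> B)) = emeasure \<gamma> (cylinder_at J a \<times> B)"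
    if "finite J" "i \<notin> J" "B \<in> sets ?C2" for J i a B
    unfolding cylinder_at_split[OF that(2), of a]
    using that disjoint_cylinder_at[of i J a]
    by (subst sum_emeasure) (auto simp: disjoint_family_on_def cylinder_at_measurable rect
        intro!: arg_cong[where f = "emeasure \<gamma>"])
  have \<gamma>_split2: "(\<Sum>c\<in>UNIV. emeasure \<gamma> (A \<times> cylinder_at (insert i J) (b(i := c)))) = emeasure \<gamma> (A \<times> cylinder_at J b)"
    if "finite J" "i \<notin> J" "A \<in> sets ?C1" for J i b A
    unfolding cylinder_at_split[OF that(2), of b]
    using that disjoint_cylinder_at[of i J b]
    by (subst sum_emeasure) (auto simp: disjoint_family_on_def cylinder_at_measurable rect
        intro!: arg_cong[where f = "emeasure \<gamma>"])
  have fst: "fst \<in> measurable \<gamma> ?C1" and snd: "snd \<in> measurable \<gamma> ?C2"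
    unfolding measurable_cong_sets[OF sets_\<gamma> refl] by (rule measurable_fst, rule measurable_snd)
  have space_\<gamma>: "space \<gamma> = UNIV"
    using sets_eq_imp_space_eq[OF sets_\<gamma>] by (simp add: space_pair_measure)
  have fst_eq: "emeasure (distr \<gamma> ?C1 fst) E = emeasure \<gamma> (E \<times> UNIV)" if "E \<in> sets ?C1" for E
    using that by (subst emeasure_distr[OF fst])
      (auto simp: space_\<gamma> vimage_fst)
  have snd_eq: "emeasure (distr \<gamma> ?C2 snd) E = emeasure \<gamma> (UNIV \<times> E)" if "E \<in> sets ?C2" for E
    using that by (subst emeasure_distr[OF snd])
      (auto simp: space_\<gamma> vimage_snd)
  have "distr \<gamma> ?C1 fst = ?U1"
  proof (rule config_measure_eqI)
    show "finite_measure (distr \<gamma> ?C1 fst)" using fst by (rule \<gamma>.finite_measure_distr)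
    fix J :: "int set" and a :: "int \<Rightarrow> 'r1" assume J: "finite J"
    have "emeasure \<gamma> (cylinder_at J a \<times> UNIV) = \<beta> (cylinder_at J a) UNIV"
      by (rule cylinder_pair_refine[where \<mu> = "\<lambda>A B. emeasure \<gamma> (A \<times> B)" and \<nu> = \<beta>])
        (simp_all add: J \<gamma>_eq \<gamma>_split2 \<beta>_split2 cylinder_at_measurable)
    then show "emeasure (distr \<gamma> ?C1 fst) (cylinder_at J a) = emeasure ?U1 (cylinder_at J a)"
      using J by (simp add: fst_eq \<beta>1 cylinder_at_measurable)
  qed simp_all
  then have marg1: "emeasure \<gamma> (E \<times> UNIV) = emeasure ?U1 E" if "E \<in> sets ?C1" for E
    using fst_eq[OF that] by simp
  have "distr \<gamma> ?C2 snd = ?U2"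
  proof (rule config_measure_eqI)
    show "finite_measure (distr \<gamma> ?C2 snd)" using snd by (rule \<gamma>.finite_measure_distr)
    fix J :: "int set" and b :: "int \<Rightarrow> 'r2" assume J: "finite J"
    have "emeasure \<gamma> (UNIV \<times> cylinder_at J b) = \<beta> UNIV (cylinder_at J b)"
      \<comment> \<open>The arguments are swapped: the cylinder of interest is now the second
        factor, and the first one is split.\<close>
      by (rule cylinder_pair_refine[where \<mu> = "\<lambda>B A. emeasure \<gamma> (A \<times> B)" and \<nu> = "\<lambda>B A. \<beta> A B"])
        (simp_all add: J \<gamma>_eq \<gamma>_split1 \<beta>_split1 cylinder_at_measurable)
    then show "emeasure (distr \<gamma> ?C2 snd) (cylinder_at J b) = emeasure ?U2 (cylinder_at J b)"
      using J by (simp add: snd_eq \<beta>2 cylinder_at_measurable)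
  qed simp_all
  then have marg2: "emeasure \<gamma> (UNIV \<times> E) = emeasure ?U2 E" if "E \<in> sets ?C2" for E
    using snd_eq[OF that] by simp
  have sets_\<gamma>': "sets \<gamma> = sets (?U1 \<Otimes>\<^sub>M ?U2)"
    unfolding sets_\<gamma> by (rule sets_pair_measure_cong) simp_all
  have null: "{(s1, s2). F1 s1 z \<noteq> F2 s2 z} \<in> null_sets \<gamma>" for z
  proof -
    \<comment> \<open>Everything that either rule reads at \<open>z\<close>. A common window is
      taken because \<open>\<gamma>_eq\<close> requires equal index sets.\<close>
    define J where "J = (\<lambda>v. z + v) ` (set (random_nbhd A1) \<union> set (random_nbhd A2))"
    have J: "finite J" by (simp add: J_def)
    have loc1: "F1 t z = F1 s z" if "t \<in> cylinder_at J s" for s t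
      unfolding F1_def by (rule explicit_global_local) (use that in \<open>auto simp: cylinder_at_def J_def\<close>)
    have loc2: "F2 t z = F2 s z" if "t \<in> cylinder_at J s" for s t
      unfolding F2_def by (rule explicit_global_local) (use that in \<open>auto simp: cylinder_at_def J_def\<close>)
    \<comment> \<open>Pairs of local patterns with different outputs at \<open>z\<close>; being
      \<open>undefined\<close> off \<open>J\<close> makes them finite in number.\<close>
    define I where "I = {(s1, s2) \<in> Pi\<^sub>E J (\<lambda>_. UNIV) \<times> Pi\<^sub>E J (\<lambda>_. UNIV). F1 s1 z \<noteq> F2 s2 z}"
    have "I \<subseteq> Pi\<^sub>E J (\<lambda>_. UNIV) \<times> Pi\<^sub>E J (\<lambda>_. UNIV)" by (auto simp: I_def)
    then have "finite I" by (rule finite_subset) (intro finite_cartesian_product finite_PiE J finite)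
    have "(\<Union>p\<in>I. cylinder_at J (fst p) \<times> cylinder_at J (snd p)) \<in> null_sets \<gamma>"
    proof (rule null_sets_UN')
      show "countable I" using \<open>finite I\<close> by (rule countable_finite)
      fix p assume p: "p \<in> I"
      \<comment> \<open>The event that separates the two images: the output at \<open>z\<close> is
        the one that the first pattern forces. The second pattern forces another.\<close>
      let ?D = "cylinder_at {z} (F1 (fst p))"
      have "\<beta> (cylinder_at J (fst p)) (cylinder_at J (snd p)) = 0"
      proof (rule \<beta>_null[of _ _ ?D])
        show "F1 a \<in> ?D" if "a \<in> cylinder_at J (fst p)" for a
          using loc1[OF that] by (simp add: cylinder_at_def)
        show "F2 b \<notin> ?D" if "b \<in> cylinder_at J (snd p)" for b
          using loc2[OF that] p by (auto simp: cylinder_at_def I_def)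
      qed (simp_all add: cylinder_at_measurable J)
      then show "cylinder_at J (fst p) \<times> cylinder_at J (snd p) \<in> null_sets \<gamma>"
        by (auto simp: null_sets_def \<gamma>_eq J rect cylinder_at_measurable)
    qed
    also have "(\<Union>p\<in>I. cylinder_at J (fst p) \<times> cylinder_at J (snd p)) = {(s1, s2). F1 s1 z \<noteq> F2 s2 z}"
    proof (intro equalityI subsetI)
      fix p assume "p \<in> {(s1, s2). F1 s1 z \<noteq> F2 s2 z}"
      then obtain s1 s2 where p: "p = (s1, s2)" "F1 s1 z \<noteq> F2 s2 z" by blast
      have mem: "s1 \<in> cylinder_at J (restrict s1 J)" "s2 \<in> cylinder_at J (restrict s2 J)"
        by (auto simp: cylinder_at_def)
      then have "(restrict s1 J, restrict s2 J) \<in> I"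
        using p(2) loc1[OF mem(1)] loc2[OF mem(2)] by (auto simp: I_def)
      then show "p \<in> (\<Union>p\<in>I. cylinder_at J (fst p) \<times> cylinder_at J (snd p))"
        using mem unfolding p(1) by force
    next
      fix p assume "p \<in> (\<Union>p\<in>I. cylinder_at J (fst p) \<times> cylinder_at J (snd p))"
      then obtain s1 s2 where "F1 s1 z \<noteq> F2 s2 z" "fst p \<in> cylinder_at J s1" "snd p \<in> cylinder_at J s2"
        by (auto simp: I_def)
      then show "p \<in> {(s1, s2). F1 s1 z \<noteq> F2 s2 z}"
        using loc1[of "fst p" s1] loc2[of "snd p" s2] by (simp add: case_prod_beta)
    qed
    finally show ?thesis .
  qed
  \<comment> \<open>There are only countably many cells \<open>z\<close>, so the null sets of
    disagreement combine.\<close>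
  have "AE p in \<gamma>. \<forall>z. F1 (fst p) z = F2 (snd p) z"
    unfolding AE_all_countable by (intro allI AE_I'[OF null]) auto
  then have "emeasure \<gamma> {(s1, s2). F1 s1 = F2 s2} = 1"
    using coincidence_set_measurable[of A1 c A2]
    by (intro \<gamma>.emeasure_eq_1_AE) (auto simp: sets_\<gamma>' F1_def F2_def fun_eq_iff)
  then have "coupled_on A1 A2 c \<gamma>"
    unfolding coupled_on_def coupling_def F1_def F2_def
    using \<gamma>.prob_space_axioms sets_\<gamma>' marg1 marg2 by simp
  then show ?thesis ..
qed

section \<open>From a coupling to equal laws\<close>

text \<open>Lifted to the product space, the preimages of an event under the two global functions
  differ only where the images differ, a null set for the coupling; the two marginal conditions
  return their masses to the uniform measures.\<close>

lemma same_law_if_coupled_on: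
  fixes A1 :: "('q::finite, 'r1::finite) sca" and A2 :: "('q, 'r2::finite) sca"
  assumes "coupled_on A1 A2 c \<gamma>"
  shows "stochastic_global A1 c = stochastic_global A2 c"
proof (rule measure_eqI)
  let ?F1 = "explicit_global A1 c" and ?F2 = "explicit_global A2 c"
  let ?U1 = "uniform_config :: (int \<Rightarrow> 'r1) measure"
  let ?U2 = "uniform_config :: (int \<Rightarrow> 'r2) measure"
  have F: "?F1 \<in> measurable ?U1 config_space" "?F2 \<in> measurable ?U2 config_space" by measurable
  have \<gamma>: "prob_space \<gamma>" "sets \<gamma> = sets (?U1 \<Otimes>\<^sub>M ?U2)"
    and marg1: "\<And>E. E \<in> sets ?U1 \<Longrightarrow> emeasure \<gamma> (E \<times> UNIV) = emeasure ?U1 E"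
    and marg2: "\<And>E. E \<in> sets ?U2 \<Longrightarrow> emeasure \<gamma> (UNIV \<times> E) = emeasure ?U2 E"
    and eq: "emeasure \<gamma> {(s1, s2). ?F1 s1 = ?F2 s2} = 1"
    using assms by (simp_all add: coupled_on_def coupling_def)
  interpret prob_space \<gamma> by fact
  have AE: "AE p in \<gamma>. p \<in> {(s1, s2). ?F1 s1 = ?F2 s2}"
    using eq by (intro AE_prob_1) (simp add: measure_def)
  fix E assume "E \<in> sets (stochastic_global A1 c)"
  then have E: "E \<in> sets config_space" by (simp add: stochastic_global_def)
  have E1: "?F1 -` E \<in> sets ?U1" and E2: "?F2 -` E \<in> sets ?U2"
    using measurable_sets[OF F(1) E] measurable_sets[OF F(2) E] by simp_all
  have "emeasure ?U1 (?F1 -` E) = emeasure \<gamma> ((?F1 -` E) \<times> UNIV)" by (rule marg1[OF E1, symmetric])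
  also have "\<dots> = emeasure \<gamma> (UNIV \<times> (?F2 -` E))"
  proof (rule emeasure_eq_AE)
    show "AE p in \<gamma>. (p \<in> (?F1 -` E) \<times> UNIV) = (p \<in> UNIV \<times> (?F2 -` E))"
      using AE by eventually_elim auto
    show "(?F1 -` E) \<times> UNIV \<in> sets \<gamma>" "UNIV \<times> (?F2 -` E) \<in> sets \<gamma>"
      unfolding \<gamma>(2) using E1 E2 sets.top[of ?U1] sets.top[of ?U2] by (auto intro!: pair_measureI)
  qed
  also have "\<dots> = emeasure ?U2 (?F2 -` E)" by (rule marg2[OF E2])
  finally show "emeasure (stochastic_global A1 c) E = emeasure (stochastic_global A2 c) E"
    unfolding stochastic_global_def by (simp add: emeasure_distr[OF F(1) E] emeasure_distr[OF F(2) E])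
qed (simp add: stochastic_global_def)

theorem theorem4p5:
  fixes A1 :: "('q::finite, 'r1::finite) sca" and A2 :: "('q, 'r2::finite) sca"
  assumes "stochastic_ca A1" and "stochastic_ca A2"
  shows "stochastic_global A1 = stochastic_global A2 \<longleftrightarrow>
         (\<forall>c :: int \<Rightarrow> 'q. \<exists>\<gamma> :: ((int \<Rightarrow> 'r1) \<times> (int \<Rightarrow> 'r2)) measure. coupled_on A1 A2 c \<gamma>)"
proof
  assume "stochastic_global A1 = stochastic_global A2"
  then show "\<forall>c. \<exists>\<gamma>. coupled_on A1 A2 c \<gamma>" by (auto intro: coupled_on_if_same_law)
next
  assume "\<forall>c. \<exists>\<gamma>. coupled_on A1 A2 c \<gamma>"
  then show "stochastic_global A1 = stochastic_global A2"
    by (auto simp: fun_eq_iff intro: same_law_if_coupled_on)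
qed

end
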